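(* Let $T$ be a context-free raw type theory. If $\vdash_T\{y_1{:}B_1\}\cdots\{y_k{:}B_k\}\{x{:}A\}\,\mathcal J$ is derivable and $x\notin\mathrm{bv}(\mathcal J)$, then $\vdash_T\{y_1{:}B_1\}\cdots\{y_k{:}B_k\}\,\mathcal J$ is derivable.
   Context: Context-free raw syntax. A signature $\Sigma$ assigns to each symbol $S$ an arity $(c,[(c_1,n_1),\dots,(c_k,n_k)])$, $c\in\{\mathrm{Ty},\mathrm{Tm}\}$, $c_i\in\{\mathrm{Ty},\mathrm{Tm},\mathrm{EqTy},\mathrm{EqTm}\}$ (the $i$-th argument has class $c_i$ and binds $n_i$ variables). Free variables are annotated with types, $a^A$ ($A$ a type expression with no unbound bound variables); $a^A$ and $b^B$ are equal iff $a=b$ and $A=B$ syntactically. Metavariables are annotated with closed boundaries, $M^{\mathcal B}$, equal iff names and boundaries coincide; $M^{\mathcal B}$ has arity $(c,m)$ where $\mathcal B=\{x_1{:}A_1\}\cdots\{x_m{:}A_m\}\beta$ and $c$ is the class of $\beta$ (Ty, Tm, EqTy, EqTm). Type expressions: $S(e_1,\dots,e_k)$, $M^{\mathcal B}(t_1,\dots,t_n)$. Term expressions: $a^A$, bound variables $x$, $S(e_1,\dots,e_k)$, $M^{\mathcal B}(t_1,\dots,t_n)$, and conversion terms $\mathrm{cv}(t,\alpha)$. Assumption sets $\alpha$ are finite sets of annotated free variables, bound variables and annotated metavariables; they are the arguments of class EqTy/EqTm. Arguments: types, terms, assumption sets, abstractions $\{x\}e$. Judgement theses: $A\ \mathsf{type}$,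 $t:A$, $A\equiv B\ \mathsf{by}\ \alpha$, $s\equiv t:A\ \mathsf{by}\ \alpha$; abstracted judgements $\mathcal J::=\text{thesis}\mid\{x{:}A\}\mathcal J$ ($x$ bound in $\mathcal J$, not in $A$). Boundary theses $\Box\ \mathsf{type}$, $\Box:A$, $A\equiv B\ \mathsf{by}\ \Box$, $s\equiv t:A\ \mathsf{by}\ \Box$; abstracted boundaries $\mathcal B::=\text{thesis}\mid\{x{:}A\}\mathcal B$. Occurrences: $\mathrm{fv}(e)$ is the set of all annotated free variables occurring in $e$ (including in assumption sets and, recursively, in type annotations of occurring variables); $\mathrm{bv}(e)$ the set of bound variables occurring free (unbound by an abstraction) in $e$, including those in assumption sets; $\mathrm{mv}(e)$ the annotated metavariables occurring in $e$ (including inside annotations, boundaries of metavariables and assumption sets); $\mathrm{asm}(e)=\mathrm{fv}(e)\cup\mathrm{bv}(e)\cup\mathrm{mv}(e)$, and $\mathrm{asm}(e_1,\dots,e_n)=\bigcup_i\mathrm{asm}(e_i)$, extended componentwise to judgements and boundaries. Substitution $e[s/x]$ replaces the bound variable $x$ by $s$ (capture-avoiding), and in an assumption set containing $x$ replaces $x$ by the elements of $\mathrm{asm}(s)$. $\mathcal J[a^A/x]$ replaces $x$ by the free variable $a^A$. Erasure $|e|$ removes all conversions ($|\mathrm{cv}(t,\alpha)|=|t|$) and replaces assumption sets by a fixed dummy, keeping annotations. Filling: $(\Box\ \mathsf{type})[A]=(A\ \mathsf{type})$, $(\Box:A)[t]=(t:A)$, $(A\equiv B\ \mathsf{by}\ \Box)[e]=(A\equiv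 B\ \mathsf{by}\ \mathrm{asm}(e))$, $(s\equiv t:A\ \mathsf{by}\ \Box)[e]=(s\equiv t:A\ \mathsf{by}\ \mathrm{asm}(e))$, $(\{x{:}A\}\mathcal B)[\{x\}e]=\{x{:}A\}(\mathcal B[e])$; with equations: $(\Box\ \mathsf{type})[A_1\equiv A_2\ \mathsf{by}\ \alpha]=(A_1\equiv A_2\ \mathsf{by}\ \alpha)$, $(\Box:A)[t_1\equiv t_2\ \mathsf{by}\ \alpha]=(t_1\equiv t_2:A\ \mathsf{by}\ \alpha)$, commuting with abstraction. An instantiation $I=\langle M_1^{\mathcal B_1}\mapsto e_1,\dots,M_n^{\mathcal B_n}\mapsto e_n\rangle$ requires $\mathrm{mv}(\mathcal B_i)\subseteq\{M_1^{\mathcal B_1},\dots,M_{i-1}^{\mathcal B_{i-1}}\}$ and matching arities; $I_*(M_i^{\mathcal B_i}(\vec t))=e_i'[I_*\vec t/\vec x]$ where $e_i=\{\vec x\}e_i'$, $I_*a^A=a^{I_*A}$, $I_*\mathrm{cv}(t,\alpha)=\mathrm{cv}(I_*t,I_*\alpha)$, $I_*\alpha=\bigcup\{\mathrm{asm}(e_i):M_i^{\mathcal B_i}\in\alpha\}\cup\{x: x\in\alpha\}\cup\{a^{I_*A}:a^A\in\alpha\}$, homomorphic elsewhere; $I_{(i)}$ is the restriction to the first $i-1$ metavariables. Rules. A context-free raw rule is $M_1^{\mathcal B_1},\dots,M_n^{\mathcal B_n}\Longrightarrow\mathcal J$ with $\mathcal B_i$ and $\mathcal J$ closed (no free variables),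 $\mathcal J$ non-abstracted, $\mathrm{mv}(\mathcal B_i)\subseteq\{M_1^{\mathcal B_1},\dots,M_{i-1}^{\mathcal B_{i-1}}\}$ and $\mathrm{mv}(\mathcal J)=\{M_1^{\mathcal B_1},\dots,M_n^{\mathcal B_n}\}$. In a closure rule with premises $p_1,\dots,p_k$ and equality conclusion $\beta[\alpha]$, "$\alpha$ suitable" means $\mathrm{asm}(p_1,\dots,p_k)=\mathrm{asm}(\beta[\alpha])$. A context-free raw type theory $T$ is a family of such rules; $\vdash_T$ denotes membership in the least set of judgements and boundaries closed under: (CF-Var) $\vdash a^A:A$; (CF-Abstr) from $\vdash A\ \mathsf{type}$ and $\vdash\mathcal J[a^A/x]$ with $a^A\notin\mathrm{fv}(\mathcal J)$ infer $\vdash\{x{:}A\}\mathcal J$; (CF-Meta) for $\mathcal B=\{x_1{:}A_1\}\cdots\{x_n{:}A_n\}\beta$: from $\vdash t_i:A_i[t_1,\dots,t_{i-1}/x_1,\dots,x_{i-1}]$ ($i=1..n$) and $\vdash\beta[\vec t/\vec x]$ infer $\vdash(\beta[\vec t/\vec x])[M^{\mathcal B}(\vec t)]$ (for equality $\beta$ the assumption set is $\mathrm{asm}(M^{\mathcal B}(\vec t))$); (CF-Meta-Congr) for $\mathcal B=\{x_1{:}A_1\}\cdots\{x_m{:}A_m\}\beta$ with $\beta$ a type or term boundary: from $\vdash s_j:A_j[\vec s_{<j}/\vec x_{<j}]$, $\vdash t_j:A_j[\vec t_{<j}/\vec x_{<j}]$, and $\vdash s_j\equiv t'_j:A_j[\vec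 s_{<j}/\vec x_{<j}]\ \mathsf{by}\ \alpha_j$ with $|t'_j|=|t_j|$ ($j=1..m$), infer $\vdash M^{\mathcal B}(\vec s)\equiv M^{\mathcal B}(\vec t)\ \mathsf{by}\ \gamma$ if $\beta=\Box\ \mathsf{type}$, and, if $\beta=(\Box:B)$, given also $\vdash v:B[\vec s/\vec x]$ with $|v|=|M^{\mathcal B}(\vec t)|$, infer $\vdash M^{\mathcal B}(\vec s)\equiv v:B[\vec s/\vec x]\ \mathsf{by}\ \gamma$ ($\gamma$ suitable); (equality) from $\vdash A_1\ \mathsf{type}$, $\vdash A_2\ \mathsf{type}$, $|A_1|=|A_2|$ infer $\vdash A_1\equiv A_2\ \mathsf{by}\ \emptyset$; from $\vdash t_1:A$, $\vdash t_2:A$, $|t_1|=|t_2|$ infer $\vdash t_1\equiv t_2:A\ \mathsf{by}\ \emptyset$; symmetry keeping the assumption set; transitivity: from $\vdash A\equiv B\ \mathsf{by}\ \alpha$ and $\vdash B'\equiv C\ \mathsf{by}\ \beta$ with $|B|=|B'|$ infer $\vdash A\equiv C\ \mathsf{by}\ \gamma$ ($\gamma$ suitable), likewise for terms at a common type $A$ with $|t|=|t'|$; (CF-Conv-Tm) from $\vdash t:A$ and $\vdash A\equiv B\ \mathsf{by}\ \alpha$ infer $\vdash\mathrm{cv}(t,\beta):B$ whenever $\mathrm{asm}(t,A,B,\alpha)=\mathrm{asm}(t,B,\beta)$; (CF-Conv-EqTm) from $\vdash s\equiv t:A\ \mathsf{by}\ \alpha$ and $\vdash A\equiv B\ \mathsf{by}\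 \beta$ infer $\vdash\mathrm{cv}(s,\gamma)\equiv\mathrm{cv}(t,\delta):B\ \mathsf{by}\ \alpha$ whenever $\mathrm{asm}(s,A,B,\beta)=\mathrm{asm}(s,B,\gamma)$ and $\mathrm{asm}(t,A,B,\beta)=\mathrm{asm}(t,B,\delta)$; (boundaries) $\vdash\Box\ \mathsf{type}$; $\vdash\Box:A$ from $\vdash A\ \mathsf{type}$; $\vdash A\equiv B\ \mathsf{by}\ \Box$ from $\vdash A\ \mathsf{type}$, $\vdash B\ \mathsf{type}$; $\vdash s\equiv t:A\ \mathsf{by}\ \Box$ from $\vdash A\ \mathsf{type}$, $\vdash s:A$, $\vdash t:A$; $\vdash\{x{:}A\}\mathcal B$ from $\vdash A\ \mathsf{type}$ and $\vdash\mathcal B[a^A/x]$ with $a^A\notin\mathrm{fv}(\mathcal B)$; (specific rules) for a specific rule $M_1^{\mathcal B_1},\dots,M_n^{\mathcal B_n}\Longrightarrow\beta[e]$ and instantiation $I=\langle M_i^{\mathcal B_i}\mapsto e_i\rangle$: from $\vdash(I_{(i)*}\mathcal B_i)[e_i]$ ($i=1..n$) and $\vdash I_*\beta$ infer $\vdash I_*(\beta[e])$; (congruence) for a specific rule with conclusion $A\ \mathsf{type}$ (resp. $t:A$) and instantiations $I=\langle M_i\mapsto f_i\rangle$, $J=\langle M_i\mapsto g_i\rangle$: from $\vdash(I_{(i)*}\mathcal B_i)[f_i]$, $\vdash(J_{(i)*}\mathcal B_i)[g_i]$ for all $i$, and for each type/term boundary $\mathcal B_i$ some $g'_i$ with $|g'_i|=|g_i|$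 and $\vdash(I_{(i)*}\mathcal B_i)[f_i\equiv g'_i\ \mathsf{by}\ \alpha_i]$, infer $\vdash I_*A\equiv J_*A\ \mathsf{by}\ \gamma$ (resp., given also $\vdash t':I_*A$ with $|t'|=|J_*t|$, infer $\vdash I_*t\equiv t':I_*A\ \mathsf{by}\ \gamma$), $\gamma$ suitable. *)

theory Defs
  imports Main "HOL-Library.FSet"
begin

section \<open>Raw syntax\<close>

text \<open>
  Bound variables are de Bruijn indices (index \<open>0\<close> is the innermost binder), so that syntactic
  equality is equality up to renaming of bound variables. Free variables and metavariables are
  named and carry their annotations.
\<close>

datatype cls = Ty | Tm | EqTy | EqTm

type_synonym name = string

type_synonym 's signature = "'s \<Rightarrow> (cls \<times> (cls \<times> nat) list) option"

definition is_signature :: "'s signature \<Rightarrow> bool" where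
  "is_signature \<Sigma> \<longleftrightarrow> (\<forall>S c as. \<Sigma> S = Some (c, as) \<longrightarrow> c = Ty \<or> c = Tm)"

text \<open>
  \<open>'s ty\<close>, \<open>'s tm\<close>, \<open>'s arg\<close>: type expressions, term expressions and arguments. An assumption set
  is an \<open>'s atom fset\<close>. \<open>'s bdry\<close>: abstracted boundaries; \<open>BEqTm s t A\<close> is the
  boundary \<open>s \<equiv> t : A by \<box>\<close>.
\<close>

datatype 's ty =
    TySym 's "'s arg list"
  | TyMeta name "'s bdry" "'s tm list"
and 's tm =
    Free name "'s ty"
  | Bound nat
  | TmSym 's "'s arg list"
  | TmMeta name "'s bdry" "'s tm list"
  | Cv "'s tm" "'s atom fset"
and 's arg =
    ArgTy "'s ty"
  | ArgTm "'s tm"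
  | ArgAsm "'s atom fset"
  | ArgAbs "'s arg"
and 's atom =
    AFree name "'s ty"
  | ABound nat
  | AMeta name "'s bdry"
and 's bdry =
    BTy
  | BTm "'s ty"
  | BEqTy "'s ty" "'s ty"
  | BEqTm "'s tm" "'s tm" "'s ty"
  | BAbs "'s ty" "'s bdry"

type_synonym 's asmset = "'s atom fset"

datatype 's jdg =
    JTy "'s ty"
  | JTm "'s tm" "'s ty"
  | JEqTy "'s ty" "'s ty" "'s asmset"
  | JEqTm "'s tm" "'s tm" "'s ty" "'s asmset"
  | JAbs "'s ty" "'s jdg"


section \<open>Occurrences\<close>

definition unbind :: "nat fset \<Rightarrow> nat fset" where
  "unbind X = (\<lambda>n. n - 1) |`| (X |-| {|0|})"

primrec fv_ty :: "'s ty \<Rightarrow> (name \<times> 's ty) fset"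
  and fv_tm :: "'s tm \<Rightarrow> (name \<times> 's ty) fset"
  and fv_arg :: "'s arg \<Rightarrow> (name \<times> 's ty) fset"
  and fv_atom :: "'s atom \<Rightarrow> (name \<times> 's ty) fset"
  and fv_bdry :: "'s bdry \<Rightarrow> (name \<times> 's ty) fset" where
  "fv_ty (TySym S es) = ffUnion (fset_of_list (map fv_arg es))"
| "fv_ty (TyMeta M B ts) = fv_bdry B |\<union>| ffUnion (fset_of_list (map fv_tm ts))"
| "fv_tm (Free a A) = finsert (a, A) (fv_ty A)"
| "fv_tm (Bound n) = {||}"
| "fv_tm (TmSym S es) = ffUnion (fset_of_list (map fv_arg es))"
| "fv_tm (TmMeta M B ts) = fv_bdry B |\<union>| ffUnion (fset_of_list (map fv_tm ts))"
| "fv_tm (Cv t \<alpha>) = fv_tm t |\<union>| ffUnion (fv_atom |`| \<alpha>)"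
| "fv_arg (ArgTy A) = fv_ty A"
| "fv_arg (ArgTm t) = fv_tm t"
| "fv_arg (ArgAsm \<alpha>) = ffUnion (fv_atom |`| \<alpha>)"
| "fv_arg (ArgAbs e) = fv_arg e"
| "fv_atom (AFree a A) = finsert (a, A) (fv_ty A)"
| "fv_atom (ABound n) = {||}"
| "fv_atom (AMeta M B) = fv_bdry B"
| "fv_bdry BTy = {||}"
| "fv_bdry (BTm A) = fv_ty A"
| "fv_bdry (BEqTy A B) = fv_ty A |\<union>| fv_ty B"
| "fv_bdry (BEqTm s t A) = fv_tm s |\<union>| fv_tm t |\<union>| fv_ty A"
| "fv_bdry (BAbs A B) = fv_ty A |\<union>| fv_bdry B"

text \<open>Annotations have no unbound bound variables (see \<open>wf_atom\<close> below), so they contribute none.\<close>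

primrec bv_atom :: "'s atom \<Rightarrow> nat fset" where
  "bv_atom (AFree a A) = {||}"
| "bv_atom (ABound n) = {|n|}"
| "bv_atom (AMeta M B) = {||}"

primrec bv_ty :: "'s ty \<Rightarrow> nat fset"
  and bv_tm :: "'s tm \<Rightarrow> nat fset"
  and bv_arg :: "'s arg \<Rightarrow> nat fset" where
  "bv_ty (TySym S es) = ffUnion (fset_of_list (map bv_arg es))"
| "bv_ty (TyMeta M B ts) = ffUnion (fset_of_list (map bv_tm ts))"
| "bv_tm (Free a A) = {||}"
| "bv_tm (Bound n) = {|n|}"
| "bv_tm (TmSym S es) = ffUnion (fset_of_list (map bv_arg es))"
| "bv_tm (TmMeta M B ts) = ffUnion (fset_of_list (map bv_tm ts))"
| "bv_tm (Cv t \<alpha>) = bv_tm t |\<union>| ffUnion (bv_atom |`| \<alpha>)"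
| "bv_arg (ArgTy A) = bv_ty A"
| "bv_arg (ArgTm t) = bv_tm t"
| "bv_arg (ArgAsm \<alpha>) = ffUnion (bv_atom |`| \<alpha>)"
| "bv_arg (ArgAbs e) = unbind (bv_arg e)"

primrec bv_bdry :: "'s bdry \<Rightarrow> nat fset" where
  "bv_bdry BTy = {||}"
| "bv_bdry (BTm A) = bv_ty A"
| "bv_bdry (BEqTy A B) = bv_ty A |\<union>| bv_ty B"
| "bv_bdry (BEqTm s t A) = bv_tm s |\<union>| bv_tm t |\<union>| bv_ty A"
| "bv_bdry (BAbs A B) = bv_ty A |\<union>| unbind (bv_bdry B)"

primrec mv_ty :: "'s ty \<Rightarrow> (name \<times> 's bdry) fset"
  and mv_tm :: "'s tm \<Rightarrow> (name \<times> 's bdry) fset"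
  and mv_arg :: "'s arg \<Rightarrow> (name \<times> 's bdry) fset"
  and mv_atom :: "'s atom \<Rightarrow> (name \<times> 's bdry) fset"
  and mv_bdry :: "'s bdry \<Rightarrow> (name \<times> 's bdry) fset" where
  "mv_ty (TySym S es) = ffUnion (fset_of_list (map mv_arg es))"
| "mv_ty (TyMeta M B ts) = finsert (M, B) (mv_bdry B |\<union>| ffUnion (fset_of_list (map mv_tm ts)))"
| "mv_tm (Free a A) = mv_ty A"
| "mv_tm (Bound n) = {||}"
| "mv_tm (TmSym S es) = ffUnion (fset_of_list (map mv_arg es))"
| "mv_tm (TmMeta M B ts) = finsert (M, B) (mv_bdry B |\<union>| ffUnion (fset_of_list (map mv_tm ts)))"
| "mv_tm (Cv t \<alpha>) = mv_tm t |\<union>| ffUnion (mv_atom |`| \<alpha>)"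
| "mv_arg (ArgTy A) = mv_ty A"
| "mv_arg (ArgTm t) = mv_tm t"
| "mv_arg (ArgAsm \<alpha>) = ffUnion (mv_atom |`| \<alpha>)"
| "mv_arg (ArgAbs e) = mv_arg e"
| "mv_atom (AFree a A) = mv_ty A"
| "mv_atom (ABound n) = {||}"
| "mv_atom (AMeta M B) = finsert (M, B) (mv_bdry B)"
| "mv_bdry BTy = {||}"
| "mv_bdry (BTm A) = mv_ty A"
| "mv_bdry (BEqTy A B) = mv_ty A |\<union>| mv_ty B"
| "mv_bdry (BEqTm s t A) = mv_tm s |\<union>| mv_tm t |\<union>| mv_ty A"
| "mv_bdry (BAbs A B) = mv_ty A |\<union>| mv_bdry B"

definition fv_asmset :: "'s asmset \<Rightarrow> (name \<times> 's ty) fset" where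
  "fv_asmset \<alpha> = ffUnion (fv_atom |`| \<alpha>)"

definition bv_asmset :: "'s asmset \<Rightarrow> nat fset" where
  "bv_asmset \<alpha> = ffUnion (bv_atom |`| \<alpha>)"

definition mv_asmset :: "'s asmset \<Rightarrow> (name \<times> 's bdry) fset" where
  "mv_asmset \<alpha> = ffUnion (mv_atom |`| \<alpha>)"

primrec fv_jdg :: "'s jdg \<Rightarrow> (name \<times> 's ty) fset" where
  "fv_jdg (JTy A) = fv_ty A"
| "fv_jdg (JTm t A) = fv_tm t |\<union>| fv_ty A"
| "fv_jdg (JEqTy A B \<alpha>) = fv_ty A |\<union>| fv_ty B |\<union>| fv_asmset \<alpha>"
| "fv_jdg (JEqTm s t A \<alpha>) = fv_tm s |\<union>| fv_tm t |\<union>| fv_ty A |\<union>| fv_asmset \<alpha>"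
| "fv_jdg (JAbs A J) = fv_ty A |\<union>| fv_jdg J"

primrec bv_jdg :: "'s jdg \<Rightarrow> nat fset" where
  "bv_jdg (JTy A) = bv_ty A"
| "bv_jdg (JTm t A) = bv_tm t |\<union>| bv_ty A"
| "bv_jdg (JEqTy A B \<alpha>) = bv_ty A |\<union>| bv_ty B |\<union>| bv_asmset \<alpha>"
| "bv_jdg (JEqTm s t A \<alpha>) = bv_tm s |\<union>| bv_tm t |\<union>| bv_ty A |\<union>| bv_asmset \<alpha>"
| "bv_jdg (JAbs A J) = bv_ty A |\<union>| unbind (bv_jdg J)"

primrec mv_jdg :: "'s jdg \<Rightarrow> (name \<times> 's bdry) fset" where
  "mv_jdg (JTy A) = mv_ty A"
| "mv_jdg (JTm t A) = mv_tm t |\<union>| mv_ty A"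
| "mv_jdg (JEqTy A B \<alpha>) = mv_ty A |\<union>| mv_ty B |\<union>| mv_asmset \<alpha>"
| "mv_jdg (JEqTm s t A \<alpha>) = mv_tm s |\<union>| mv_tm t |\<union>| mv_ty A |\<union>| mv_asmset \<alpha>"
| "mv_jdg (JAbs A J) = mv_ty A |\<union>| mv_jdg J"

definition atoms :: "(name \<times> 's ty) fset \<Rightarrow> nat fset \<Rightarrow> (name \<times> 's bdry) fset \<Rightarrow> 's asmset" where
  "atoms X Y Z = (\<lambda>(a, A). AFree a A) |`| X |\<union>| ABound |`| Y |\<union>| (\<lambda>(M, B). AMeta M B) |`| Z"

definition asm_ty :: "'s ty \<Rightarrow> 's asmset" where
  "asm_ty A = atoms (fv_ty A) (bv_ty A) (mv_ty A)"

definition asm_tm :: "'s tm \<Rightarrow> 's asmset" where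
  "asm_tm t = atoms (fv_tm t) (bv_tm t) (mv_tm t)"

definition asm_arg :: "'s arg \<Rightarrow> 's asmset" where
  "asm_arg e = atoms (fv_arg e) (bv_arg e) (mv_arg e)"

definition asm_asmset :: "'s asmset \<Rightarrow> 's asmset" where
  "asm_asmset \<alpha> = atoms (fv_asmset \<alpha>) (bv_asmset \<alpha>) (mv_asmset \<alpha>)"

definition asm_jdg :: "'s jdg \<Rightarrow> 's asmset" where
  "asm_jdg J = atoms (fv_jdg J) (bv_jdg J) (mv_jdg J)"

definition closed_bdry :: "'s bdry \<Rightarrow> bool" where
  "closed_bdry B \<longleftrightarrow> fv_bdry B = {||} \<and> bv_bdry B = {||}"

definition closed_jdg :: "'s jdg \<Rightarrow> bool" where
  "closed_jdg J \<longleftrightarrow> fv_jdg J = {||} \<and> bv_jdg J = {||}"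


section \<open>Well-formed raw expressions over a signature\<close>

primrec doms :: "'s bdry \<Rightarrow> 's ty list" where
  "doms BTy = []"
| "doms (BTm A) = []"
| "doms (BEqTy A B) = []"
| "doms (BEqTm s t A) = []"
| "doms (BAbs A B) = A # doms B"

primrec core :: "'s bdry \<Rightarrow> 's bdry" where
  "core BTy = BTy"
| "core (BTm A) = BTm A"
| "core (BEqTy A B) = BEqTy A B"
| "core (BEqTm s t A) = BEqTm s t A"
| "core (BAbs A B) = core B"

primrec cls_of :: "'s bdry \<Rightarrow> cls" where
  "cls_of BTy = Ty"
| "cls_of (BTm A) = Tm"
| "cls_of (BEqTy A B) = EqTy"
| "cls_of (BEqTm s t A) = EqTm"
| "cls_of (BAbs A B) = cls_of B"

definition arity_of :: "'s bdry \<Rightarrow> cls \<times> nat" where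
  "arity_of B = (cls_of B, length (doms B))"

inductive wf_ty :: "'s signature \<Rightarrow> 's ty \<Rightarrow> bool"
  and wf_tm :: "'s signature \<Rightarrow> 's tm \<Rightarrow> bool"
  and wf_arg :: "'s signature \<Rightarrow> 's arg \<Rightarrow> cls \<times> nat \<Rightarrow> bool"
  and wf_atom :: "'s signature \<Rightarrow> 's atom \<Rightarrow> bool"
  and wf_bdry :: "'s signature \<Rightarrow> 's bdry \<Rightarrow> bool"
  for \<Sigma> :: "'s signature" where
  "\<Sigma> S = Some (Ty, as) \<Longrightarrow> list_all2 (wf_arg \<Sigma>) es as \<Longrightarrow> wf_ty \<Sigma> (TySym S es)"
| "wf_atom \<Sigma> (AMeta M B) \<Longrightarrow> arity_of B = (Ty, length ts) \<Longrightarrow> \<forall>t\<in>set ts. wf_tm \<Sigma> t \<Longrightarrow>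
    wf_ty \<Sigma> (TyMeta M B ts)"
| "wf_atom \<Sigma> (AFree a A) \<Longrightarrow> wf_tm \<Sigma> (Free a A)"
| "wf_tm \<Sigma> (Bound n)"
| "\<Sigma> S = Some (Tm, as) \<Longrightarrow> list_all2 (wf_arg \<Sigma>) es as \<Longrightarrow> wf_tm \<Sigma> (TmSym S es)"
| "wf_atom \<Sigma> (AMeta M B) \<Longrightarrow> arity_of B = (Tm, length ts) \<Longrightarrow> \<forall>t\<in>set ts. wf_tm \<Sigma> t \<Longrightarrow>
    wf_tm \<Sigma> (TmMeta M B ts)"
| "wf_tm \<Sigma> t \<Longrightarrow> \<forall>x\<in>fset \<alpha>. wf_atom \<Sigma> x \<Longrightarrow> wf_tm \<Sigma> (Cv t \<alpha>)"
| "wf_ty \<Sigma> A \<Longrightarrow> wf_arg \<Sigma> (ArgTy A) (Ty, 0)"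
| "wf_tm \<Sigma> t \<Longrightarrow> wf_arg \<Sigma> (ArgTm t) (Tm, 0)"
| "c = EqTy \<or> c = EqTm \<Longrightarrow> \<forall>x\<in>fset \<alpha>. wf_atom \<Sigma> x \<Longrightarrow> wf_arg \<Sigma> (ArgAsm \<alpha>) (c, 0)"
| "wf_arg \<Sigma> e (c, n) \<Longrightarrow> wf_arg \<Sigma> (ArgAbs e) (c, Suc n)"
| "wf_ty \<Sigma> A \<Longrightarrow> bv_ty A = {||} \<Longrightarrow> wf_atom \<Sigma> (AFree a A)"
| "wf_atom \<Sigma> (ABound n)"
| "wf_bdry \<Sigma> B \<Longrightarrow> closed_bdry B \<Longrightarrow> wf_atom \<Sigma> (AMeta M B)"
| "wf_bdry \<Sigma> BTy"
| "wf_ty \<Sigma> A \<Longrightarrow> wf_bdry \<Sigma> (BTm A)"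
| "wf_ty \<Sigma> A \<Longrightarrow> wf_ty \<Sigma> B \<Longrightarrow> wf_bdry \<Sigma> (BEqTy A B)"
| "wf_tm \<Sigma> s \<Longrightarrow> wf_tm \<Sigma> t \<Longrightarrow> wf_ty \<Sigma> A \<Longrightarrow> wf_bdry \<Sigma> (BEqTm s t A)"
| "wf_ty \<Sigma> A \<Longrightarrow> wf_bdry \<Sigma> \<B> \<Longrightarrow> wf_bdry \<Sigma> (BAbs A \<B>)"

primrec wf_jdg :: "'s signature \<Rightarrow> 's jdg \<Rightarrow> bool" where
  "wf_jdg \<Sigma> (JTy A) \<longleftrightarrow> wf_ty \<Sigma> A"
| "wf_jdg \<Sigma> (JTm t A) \<longleftrightarrow> wf_tm \<Sigma> t \<and> wf_ty \<Sigma> A"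
| "wf_jdg \<Sigma> (JEqTy A B \<alpha>) \<longleftrightarrow> wf_ty \<Sigma> A \<and> wf_ty \<Sigma> B \<and> (\<forall>x\<in>fset \<alpha>. wf_atom \<Sigma> x)"
| "wf_jdg \<Sigma> (JEqTm s t A \<alpha>) \<longleftrightarrow>
    wf_tm \<Sigma> s \<and> wf_tm \<Sigma> t \<and> wf_ty \<Sigma> A \<and> (\<forall>x\<in>fset \<alpha>. wf_atom \<Sigma> x)"
| "wf_jdg \<Sigma> (JAbs A J) \<longleftrightarrow> wf_ty \<Sigma> A \<and> wf_jdg \<Sigma> J"


section \<open>Renaming and substitution of bound variables\<close>

definition up_ren :: "(nat \<Rightarrow> nat) \<Rightarrow> nat \<Rightarrow> nat" where
  "up_ren f = case_nat 0 (\<lambda>n. Suc (f n))"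

primrec ren_atom :: "(nat \<Rightarrow> nat) \<Rightarrow> 's atom \<Rightarrow> 's atom" where
  "ren_atom f (AFree a A) = AFree a A"
| "ren_atom f (ABound n) = ABound (f n)"
| "ren_atom f (AMeta M B) = AMeta M B"

primrec ren_ty :: "'s ty \<Rightarrow> (nat \<Rightarrow> nat) \<Rightarrow> 's ty"
  and ren_tm :: "'s tm \<Rightarrow> (nat \<Rightarrow> nat) \<Rightarrow> 's tm"
  and ren_arg :: "'s arg \<Rightarrow> (nat \<Rightarrow> nat) \<Rightarrow> 's arg" where
  "ren_ty (TySym S es) f = TySym S (map (\<lambda>e. ren_arg e f) es)"
| "ren_ty (TyMeta M B ts) f = TyMeta M B (map (\<lambda>t. ren_tm t f) ts)"
| "ren_tm (Free a A) f = Free a A"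
| "ren_tm (Bound n) f = Bound (f n)"
| "ren_tm (TmSym S es) f = TmSym S (map (\<lambda>e. ren_arg e f) es)"
| "ren_tm (TmMeta M B ts) f = TmMeta M B (map (\<lambda>t. ren_tm t f) ts)"
| "ren_tm (Cv t \<alpha>) f = Cv (ren_tm t f) (ren_atom f |`| \<alpha>)"
| "ren_arg (ArgTy A) f = ArgTy (ren_ty A f)"
| "ren_arg (ArgTm t) f = ArgTm (ren_tm t f)"
| "ren_arg (ArgAsm \<alpha>) f = ArgAsm (ren_atom f |`| \<alpha>)"
| "ren_arg (ArgAbs e) f = ArgAbs (ren_arg e (up_ren f))"

primrec ren_jdg :: "'s jdg \<Rightarrow> (nat \<Rightarrow> nat) \<Rightarrow> 's jdg" where
  "ren_jdg (JTy A) f = JTy (ren_ty A f)"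
| "ren_jdg (JTm t A) f = JTm (ren_tm t f) (ren_ty A f)"
| "ren_jdg (JEqTy A B \<alpha>) f = JEqTy (ren_ty A f) (ren_ty B f) (ren_atom f |`| \<alpha>)"
| "ren_jdg (JEqTm s t A \<alpha>) f = JEqTm (ren_tm s f) (ren_tm t f) (ren_ty A f) (ren_atom f |`| \<alpha>)"
| "ren_jdg (JAbs A J) f = JAbs (ren_ty A f) (ren_jdg J (up_ren f))"

text \<open>
  If index \<open>0\<close> does not occur in \<open>J\<close>, then \<open>unshift_jdg J\<close> is the same judgement read outside the
  scope of the innermost enclosing binder.
\<close>

definition unshift_jdg :: "'s jdg \<Rightarrow> 's jdg" where
  "unshift_jdg J = ren_jdg J (\<lambda>n. n - 1)"

definition up :: "(nat \<Rightarrow> 's tm) \<Rightarrow> nat \<Rightarrow> 's tm" where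
  "up \<sigma> = case_nat (Bound 0) (\<lambda>n. ren_tm (\<sigma> n) Suc)"

primrec subst_atom :: "(nat \<Rightarrow> 's tm) \<Rightarrow> 's atom \<Rightarrow> 's asmset" where
  "subst_atom \<sigma> (AFree a A) = {|AFree a A|}"
| "subst_atom \<sigma> (ABound n) = asm_tm (\<sigma> n)"
| "subst_atom \<sigma> (AMeta M B) = {|AMeta M B|}"

definition subst_asmset :: "'s asmset \<Rightarrow> (nat \<Rightarrow> 's tm) \<Rightarrow> 's asmset" where
  "subst_asmset \<alpha> \<sigma> = ffUnion (subst_atom \<sigma> |`| \<alpha>)"

primrec subst_ty :: "'s ty \<Rightarrow> (nat \<Rightarrow> 's tm) \<Rightarrow> 's ty"
  and subst_tm :: "'s tm \<Rightarrow> (nat \<Rightarrow> 's tm) \<Rightarrow> 's tm"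
  and subst_arg :: "'s arg \<Rightarrow> (nat \<Rightarrow> 's tm) \<Rightarrow> 's arg" where
  "subst_ty (TySym S es) \<sigma> = TySym S (map (\<lambda>e. subst_arg e \<sigma>) es)"
| "subst_ty (TyMeta M B ts) \<sigma> = TyMeta M B (map (\<lambda>t. subst_tm t \<sigma>) ts)"
| "subst_tm (Free a A) \<sigma> = Free a A"
| "subst_tm (Bound n) \<sigma> = \<sigma> n"
| "subst_tm (TmSym S es) \<sigma> = TmSym S (map (\<lambda>e. subst_arg e \<sigma>) es)"
| "subst_tm (TmMeta M B ts) \<sigma> = TmMeta M B (map (\<lambda>t. subst_tm t \<sigma>) ts)"
| "subst_tm (Cv t \<alpha>) \<sigma> = Cv (subst_tm t \<sigma>) (subst_asmset \<alpha> \<sigma>)"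
| "subst_arg (ArgTy A) \<sigma> = ArgTy (subst_ty A \<sigma>)"
| "subst_arg (ArgTm t) \<sigma> = ArgTm (subst_tm t \<sigma>)"
| "subst_arg (ArgAsm \<alpha>) \<sigma> = ArgAsm (subst_asmset \<alpha> \<sigma>)"
| "subst_arg (ArgAbs e) \<sigma> = ArgAbs (subst_arg e (up \<sigma>))"

primrec subst_bdry :: "'s bdry \<Rightarrow> (nat \<Rightarrow> 's tm) \<Rightarrow> 's bdry" where
  "subst_bdry BTy \<sigma> = BTy"
| "subst_bdry (BTm A) \<sigma> = BTm (subst_ty A \<sigma>)"
| "subst_bdry (BEqTy A B) \<sigma> = BEqTy (subst_ty A \<sigma>) (subst_ty B \<sigma>)"
| "subst_bdry (BEqTm s t A) \<sigma> = BEqTm (subst_tm s \<sigma>) (subst_tm t \<sigma>) (subst_ty A \<sigma>)"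
| "subst_bdry (BAbs A B) \<sigma> = BAbs (subst_ty A \<sigma>) (subst_bdry B (up \<sigma>))"

primrec subst_jdg :: "'s jdg \<Rightarrow> (nat \<Rightarrow> 's tm) \<Rightarrow> 's jdg" where
  "subst_jdg (JTy A) \<sigma> = JTy (subst_ty A \<sigma>)"
| "subst_jdg (JTm t A) \<sigma> = JTm (subst_tm t \<sigma>) (subst_ty A \<sigma>)"
| "subst_jdg (JEqTy A B \<alpha>) \<sigma> = JEqTy (subst_ty A \<sigma>) (subst_ty B \<sigma>) (subst_asmset \<alpha> \<sigma>)"
| "subst_jdg (JEqTm s t A \<alpha>) \<sigma> =
    JEqTm (subst_tm s \<sigma>) (subst_tm t \<sigma>) (subst_ty A \<sigma>) (subst_asmset \<alpha> \<sigma>)"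
| "subst_jdg (JAbs A J) \<sigma> = JAbs (subst_ty A \<sigma>) (subst_jdg J (up \<sigma>))"

text \<open>
  \<open>bind [t\<^sub>1, \<dots>, t\<^sub>n]\<close> is the substitution \<open>[t\<^sub>1, \<dots>, t\<^sub>n / x\<^sub>1, \<dots>, x\<^sub>n]\<close> for the \<open>n\<close> innermost
  binders, of which \<open>x\<^sub>n\<close> has index \<open>0\<close>.
\<close>

definition bind :: "'s tm list \<Rightarrow> nat \<Rightarrow> 's tm" where
  "bind ts n = (if n < length ts then rev ts ! n else Bound (n - length ts))"


section \<open>Erasure\<close>

text \<open>
  The erased expressions are represented inside the raw expressions, with the empty assumption set
  as the dummy.
\<close>

primrec er_ty :: "'s ty \<Rightarrow> 's ty"
  and er_tm :: "'s tm \<Rightarrow> 's tm"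
  and er_arg :: "'s arg \<Rightarrow> 's arg" where
  "er_ty (TySym S es) = TySym S (map er_arg es)"
| "er_ty (TyMeta M B ts) = TyMeta M B (map er_tm ts)"
| "er_tm (Free a A) = Free a A"
| "er_tm (Bound n) = Bound n"
| "er_tm (TmSym S es) = TmSym S (map er_arg es)"
| "er_tm (TmMeta M B ts) = TmMeta M B (map er_tm ts)"
| "er_tm (Cv t \<alpha>) = er_tm t"
| "er_arg (ArgTy A) = ArgTy (er_ty A)"
| "er_arg (ArgTm t) = ArgTm (er_tm t)"
| "er_arg (ArgAsm \<alpha>) = ArgAsm {||}"
| "er_arg (ArgAbs e) = ArgAbs (er_arg e)"


section \<open>Filling\<close>

text \<open>
  Both functions are only used for arguments of the arity of the boundary; they are unspecified
  otherwise. In \<open>fill_eq B e\<^sub>1 e\<^sub>2 \<alpha>\<close> the assumption set \<open>\<alpha>\<close> lives in the scope of all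
  the abstractions of \<open>B\<close>.
\<close>

fun fill :: "'s bdry \<Rightarrow> 's arg \<Rightarrow> 's jdg" where
  "fill BTy (ArgTy A) = JTy A"
| "fill (BTm A) (ArgTm t) = JTm t A"
| "fill (BEqTy A B) e = JEqTy A B (asm_arg e)"
| "fill (BEqTm s t A) e = JEqTm s t A (asm_arg e)"
| "fill (BAbs A B) (ArgAbs e) = JAbs A (fill B e)"

fun fill_eq :: "'s bdry \<Rightarrow> 's arg \<Rightarrow> 's arg \<Rightarrow> 's asmset \<Rightarrow> 's jdg" where
  "fill_eq BTy (ArgTy A\<^sub>1) (ArgTy A\<^sub>2) \<alpha> = JEqTy A\<^sub>1 A\<^sub>2 \<alpha>"
| "fill_eq (BTm A) (ArgTm t\<^sub>1) (ArgTm t\<^sub>2) \<alpha> = JEqTm t\<^sub>1 t\<^sub>2 A \<alpha>"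
| "fill_eq (BAbs A B) (ArgAbs e\<^sub>1) (ArgAbs e\<^sub>2) \<alpha> = JAbs A (fill_eq B e\<^sub>1 e\<^sub>2 \<alpha>)"

primrec bdry_of :: "'s jdg \<Rightarrow> 's bdry" where
  "bdry_of (JTy A) = BTy"
| "bdry_of (JTm t A) = BTm A"
| "bdry_of (JEqTy A B \<alpha>) = BEqTy A B"
| "bdry_of (JEqTm s t A \<alpha>) = BEqTm s t A"
| "bdry_of (JAbs A J) = BAbs A (bdry_of J)"

text \<open>
  The generic application \<open>M(ts)\<close> as a head filling the boundary of \<open>M\<close>. For an equality
  boundary it is not an expression; what fills the boundary is its set \<open>asm(M(ts))\<close>.
\<close>

definition meta_app :: "name \<Rightarrow> 's bdry \<Rightarrow> 's tm list \<Rightarrow> 's arg" where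
  "meta_app M B ts = (case cls_of B of
      Ty \<Rightarrow> ArgTy (TyMeta M B ts)
    | Tm \<Rightarrow> ArgTm (TmMeta M B ts)
    | _ \<Rightarrow> ArgAsm (asm_asmset {|AMeta M B|} |\<union>| ffUnion (fset_of_list (map asm_tm ts))))"


section \<open>Instantiations\<close>

type_synonym 's inst = "((name \<times> 's bdry) \<times> 's arg) list"

primrec strip_abs :: "'s arg \<Rightarrow> 's arg" where
  "strip_abs (ArgTy A) = ArgTy A"
| "strip_abs (ArgTm t) = ArgTm t"
| "strip_abs (ArgAsm \<alpha>) = ArgAsm \<alpha>"
| "strip_abs (ArgAbs e) = strip_abs e"

definition app_ty :: "'s arg \<Rightarrow> 's tm list \<Rightarrow> 's ty" where
  "app_ty e ts = (case strip_abs e of ArgTy A \<Rightarrow> subst_ty A (bind ts))"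

definition app_tm :: "'s arg \<Rightarrow> 's tm list \<Rightarrow> 's tm" where
  "app_tm e ts = (case strip_abs e of ArgTm t \<Rightarrow> subst_tm t (bind ts))"

text \<open>
  The arguments of an instantiation have no unbound bound variables (see \<open>instantiation_of\<close> below),
  hence need no lifting under binders. Metavariables outside the domain are left alone.
\<close>

primrec inst_ty :: "'s inst \<Rightarrow> 's ty \<Rightarrow> 's ty"
  and inst_tm :: "'s inst \<Rightarrow> 's tm \<Rightarrow> 's tm"
  and inst_arg :: "'s inst \<Rightarrow> 's arg \<Rightarrow> 's arg"
  and inst_atom :: "'s inst \<Rightarrow> 's atom \<Rightarrow> 's asmset" where
  "inst_ty I (TySym S es) = TySym S (map (inst_arg I) es)"
| "inst_ty I (TyMeta M B ts) = (case map_of I (M, B) of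
      None \<Rightarrow> TyMeta M B (map (inst_tm I) ts)
    | Some e \<Rightarrow> app_ty e (map (inst_tm I) ts))"
| "inst_tm I (Free a A) = Free a (inst_ty I A)"
| "inst_tm I (Bound n) = Bound n"
| "inst_tm I (TmSym S es) = TmSym S (map (inst_arg I) es)"
| "inst_tm I (TmMeta M B ts) = (case map_of I (M, B) of
      None \<Rightarrow> TmMeta M B (map (inst_tm I) ts)
    | Some e \<Rightarrow> app_tm e (map (inst_tm I) ts))"
| "inst_tm I (Cv t \<alpha>) = Cv (inst_tm I t) (ffUnion (inst_atom I |`| \<alpha>))"
| "inst_arg I (ArgTy A) = ArgTy (inst_ty I A)"
| "inst_arg I (ArgTm t) = ArgTm (inst_tm I t)"
| "inst_arg I (ArgAsm \<alpha>) = ArgAsm (ffUnion (inst_atom I |`| \<alpha>))"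
| "inst_arg I (ArgAbs e) = ArgAbs (inst_arg I e)"
| "inst_atom I (AFree a A) = {|AFree a (inst_ty I A)|}"
| "inst_atom I (ABound n) = {|ABound n|}"
| "inst_atom I (AMeta M B) = (case map_of I (M, B) of
      None \<Rightarrow> {|AMeta M B|}
    | Some e \<Rightarrow> asm_arg e)"

definition inst_asmset :: "'s inst \<Rightarrow> 's asmset \<Rightarrow> 's asmset" where
  "inst_asmset I \<alpha> = ffUnion (inst_atom I |`| \<alpha>)"

primrec inst_bdry :: "'s inst \<Rightarrow> 's bdry \<Rightarrow> 's bdry" where
  "inst_bdry I BTy = BTy"
| "inst_bdry I (BTm A) = BTm (inst_ty I A)"
| "inst_bdry I (BEqTy A B) = BEqTy (inst_ty I A) (inst_ty I B)"
| "inst_bdry I (BEqTm s t A) = BEqTm (inst_tm I s) (inst_tm I t) (inst_ty I A)"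
| "inst_bdry I (BAbs A B) = BAbs (inst_ty I A) (inst_bdry I B)"

primrec inst_jdg :: "'s inst \<Rightarrow> 's jdg \<Rightarrow> 's jdg" where
  "inst_jdg I (JTy A) = JTy (inst_ty I A)"
| "inst_jdg I (JTm t A) = JTm (inst_tm I t) (inst_ty I A)"
| "inst_jdg I (JEqTy A B \<alpha>) = JEqTy (inst_ty I A) (inst_ty I B) (inst_asmset I \<alpha>)"
| "inst_jdg I (JEqTm s t A \<alpha>) =
    JEqTm (inst_tm I s) (inst_tm I t) (inst_ty I A) (inst_asmset I \<alpha>)"
| "inst_jdg I (JAbs A J) = JAbs (inst_ty I A) (inst_jdg I J)"

text \<open>\<open>Ms\<close> is a list of annotated metavariables in which each boundary mentions only earlier ones.\<close>

definition telescopic :: "(name \<times> 's bdry) list \<Rightarrow> bool" where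
  "telescopic Ms \<longleftrightarrow> (\<forall>i<length Ms. fset (mv_bdry (snd (Ms ! i))) \<subseteq> set (take i Ms))"

definition instantiation_of ::
    "'s signature \<Rightarrow> (name \<times> 's bdry) list \<Rightarrow> 's inst \<Rightarrow> bool" where
  "instantiation_of \<Sigma> Ms I \<longleftrightarrow>
    map fst I = Ms \<and> telescopic Ms \<and> single_valued (set I) \<and>
    (\<forall>((M, B), e) \<in> set I. wf_arg \<Sigma> e (arity_of B) \<and> bv_arg e = {||})"


section \<open>Context-free raw rules and type theories\<close>

type_synonym 's rule = "(name \<times> 's bdry) list \<times> 's jdg"

definition raw_rule :: "'s signature \<Rightarrow> 's rule \<Rightarrow> bool" where
  "raw_rule \<Sigma> R \<longleftrightarrow> (case R of (Ms, J) \<Rightarrow>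
    (\<forall>(M, B) \<in> set Ms. wf_bdry \<Sigma> B \<and> closed_bdry B) \<and>
    telescopic Ms \<and>
    wf_jdg \<Sigma> J \<and> closed_jdg J \<and> (\<nexists>A J'. J = JAbs A J') \<and>
    fset (mv_jdg J) = set Ms)"

definition raw_type_theory :: "'s signature \<Rightarrow> 's rule set \<Rightarrow> bool" where
  "raw_type_theory \<Sigma> T \<longleftrightarrow> is_signature \<Sigma> \<and> (\<forall>R\<in>T. raw_rule \<Sigma> R)"


section \<open>Derivability\<close>

definition suitable :: "'s jdg list \<Rightarrow> 's jdg \<Rightarrow> bool" where
  "suitable ps J \<longleftrightarrow> ffUnion (fset_of_list (map asm_jdg ps)) = asm_jdg J"

text \<open>\<open>A\<^sub>j[t\<^sub>1, \<dots>, t\<^sub>j\<^sub>-\<^sub>1 / x\<^sub>1, \<dots>, x\<^sub>j\<^sub>-\<^sub>1]\<close>, counting \<open>j\<close> from \<open>0\<close>.\<close>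

definition dom_at :: "'s bdry \<Rightarrow> 's tm list \<Rightarrow> nat \<Rightarrow> 's ty" where
  "dom_at B ts j = subst_ty (doms B ! j) (bind (take j ts))"

definition meta_prems :: "'s bdry \<Rightarrow> 's tm list \<Rightarrow> 's jdg list" where
  "meta_prems B ts = map (\<lambda>j. JTm (ts ! j) (dom_at B ts j)) [0..<length (doms B)]"

definition meta_eq_prems ::
    "'s bdry \<Rightarrow> 's tm list \<Rightarrow> 's tm list \<Rightarrow> 's asmset list \<Rightarrow> 's jdg list" where
  "meta_eq_prems B ss ts' \<alpha>s =
    map (\<lambda>j. JEqTm (ss ! j) (ts' ! j) (dom_at B ss j) (\<alpha>s ! j)) [0..<length (doms B)]"

definition inst_prems :: "'s inst \<Rightarrow> 's jdg list" where
  "inst_prems I =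
    map (\<lambda>i. fill (inst_bdry (take i I) (snd (fst (I ! i)))) (snd (I ! i))) [0..<length I]"

definition obj_indices :: "'s inst \<Rightarrow> nat list" where
  "obj_indices I = filter (\<lambda>i. cls_of (snd (fst (I ! i))) \<in> {Ty, Tm}) [0..<length I]"

definition inst_eq_prems :: "'s inst \<Rightarrow> (nat \<Rightarrow> 's arg) \<Rightarrow> (nat \<Rightarrow> 's asmset) \<Rightarrow> 's jdg list" where
  "inst_eq_prems I g' \<alpha> =
    map (\<lambda>i. fill_eq (inst_bdry (take i I) (snd (fst (I ! i)))) (snd (I ! i)) (g' i) (\<alpha> i))
      (obj_indices I)"

text \<open>
  The explicit well-formedness premises are imposed only where a rule introduces raw syntax that
  does not already occur in its derivable premises.
\<close>

inductive derivable :: "'s signature \<Rightarrow> 's rule set \<Rightarrow> 's jdg \<Rightarrow> bool"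
  and derivable_bdry :: "'s signature \<Rightarrow> 's rule set \<Rightarrow> 's bdry \<Rightarrow> bool"
  for \<Sigma> :: "'s signature" and T :: "'s rule set" where
  Var: "wf_atom \<Sigma> (AFree a A) \<Longrightarrow> derivable \<Sigma> T (JTm (Free a A) A)"
| Abstr: "derivable \<Sigma> T (JTy A) \<Longrightarrow> derivable \<Sigma> T (subst_jdg J (bind [Free a A])) \<Longrightarrow>
    (a, A) |\<notin>| fv_jdg J \<Longrightarrow> derivable \<Sigma> T (JAbs A J)"
| Meta: "wf_atom \<Sigma> (AMeta M B) \<Longrightarrow> length ts = length (doms B) \<Longrightarrow>
    \<forall>p\<in>set (meta_prems B ts). derivable \<Sigma> T p \<Longrightarrow>
    derivable_bdry \<Sigma> T (subst_bdry (core B) (bind ts)) \<Longrightarrow>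
    derivable \<Sigma> T (fill (subst_bdry (core B) (bind ts)) (meta_app M B ts))"
| Meta_Congr_Ty: "wf_atom \<Sigma> (AMeta M B) \<Longrightarrow> core B = BTy \<Longrightarrow>
    length ss = length (doms B) \<Longrightarrow> length ts = length (doms B) \<Longrightarrow>
    length \<alpha>s = length (doms B) \<Longrightarrow> map er_tm ts' = map er_tm ts \<Longrightarrow>
    ps = meta_prems B ss @ meta_prems B ts @ meta_eq_prems B ss ts' \<alpha>s \<Longrightarrow>
    \<forall>p\<in>set ps. derivable \<Sigma> T p \<Longrightarrow>
    J = JEqTy (TyMeta M B ss) (TyMeta M B ts) \<gamma> \<Longrightarrow> suitable ps J \<Longrightarrow>
    derivable \<Sigma> T J"
| Meta_Congr_Tm: "wf_atom \<Sigma> (AMeta M B) \<Longrightarrow> core B = BTm C \<Longrightarrow>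
    length ss = length (doms B) \<Longrightarrow> length ts = length (doms B) \<Longrightarrow>
    length \<alpha>s = length (doms B) \<Longrightarrow> map er_tm ts' = map er_tm ts \<Longrightarrow>
    er_tm v = er_tm (TmMeta M B ts) \<Longrightarrow>
    ps = meta_prems B ss @ meta_prems B ts @ meta_eq_prems B ss ts' \<alpha>s @
      [JTm v (subst_ty C (bind ss))] \<Longrightarrow>
    \<forall>p\<in>set ps. derivable \<Sigma> T p \<Longrightarrow>
    J = JEqTm (TmMeta M B ss) v (subst_ty C (bind ss)) \<gamma> \<Longrightarrow> suitable ps J \<Longrightarrow>
    derivable \<Sigma> T J"
| EqTy_Refl: "derivable \<Sigma> T (JTy A\<^sub>1) \<Longrightarrow> derivable \<Sigma> T (JTy A\<^sub>2) \<Longrightarrow> er_ty A\<^sub>1 = er_ty A\<^sub>2 \<Longrightarrow>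
    derivable \<Sigma> T (JEqTy A\<^sub>1 A\<^sub>2 {||})"
| EqTm_Refl: "derivable \<Sigma> T (JTm t\<^sub>1 A) \<Longrightarrow> derivable \<Sigma> T (JTm t\<^sub>2 A) \<Longrightarrow> er_tm t\<^sub>1 = er_tm t\<^sub>2 \<Longrightarrow>
    derivable \<Sigma> T (JEqTm t\<^sub>1 t\<^sub>2 A {||})"
| EqTy_Sym: "derivable \<Sigma> T (JEqTy A B \<alpha>) \<Longrightarrow> derivable \<Sigma> T (JEqTy B A \<alpha>)"
| EqTm_Sym: "derivable \<Sigma> T (JEqTm s t A \<alpha>) \<Longrightarrow> derivable \<Sigma> T (JEqTm t s A \<alpha>)"
| EqTy_Trans: "derivable \<Sigma> T (JEqTy A B \<alpha>) \<Longrightarrow> derivable \<Sigma> T (JEqTy B' C \<beta>) \<Longrightarrow>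
    er_ty B = er_ty B' \<Longrightarrow> suitable [JEqTy A B \<alpha>, JEqTy B' C \<beta>] (JEqTy A C \<gamma>) \<Longrightarrow>
    derivable \<Sigma> T (JEqTy A C \<gamma>)"
| EqTm_Trans: "derivable \<Sigma> T (JEqTm s t A \<alpha>) \<Longrightarrow> derivable \<Sigma> T (JEqTm t' u A \<beta>) \<Longrightarrow>
    er_tm t = er_tm t' \<Longrightarrow> suitable [JEqTm s t A \<alpha>, JEqTm t' u A \<beta>] (JEqTm s u A \<gamma>) \<Longrightarrow>
    derivable \<Sigma> T (JEqTm s u A \<gamma>)"
| Conv_Tm: "derivable \<Sigma> T (JTm t A) \<Longrightarrow> derivable \<Sigma> T (JEqTy A B \<alpha>) \<Longrightarrow>
    asm_tm t |\<union>| asm_ty A |\<union>| asm_ty B |\<union>| asm_asmset \<alpha> =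
      asm_tm t |\<union>| asm_ty B |\<union>| asm_asmset \<beta> \<Longrightarrow>
    derivable \<Sigma> T (JTm (Cv t \<beta>) B)"
| Conv_EqTm: "derivable \<Sigma> T (JEqTm s t A \<alpha>) \<Longrightarrow> derivable \<Sigma> T (JEqTy A B \<beta>) \<Longrightarrow>
    asm_tm s |\<union>| asm_ty A |\<union>| asm_ty B |\<union>| asm_asmset \<beta> =
      asm_tm s |\<union>| asm_ty B |\<union>| asm_asmset \<gamma> \<Longrightarrow>
    asm_tm t |\<union>| asm_ty A |\<union>| asm_ty B |\<union>| asm_asmset \<beta> =
      asm_tm t |\<union>| asm_ty B |\<union>| asm_asmset \<delta> \<Longrightarrow>
    derivable \<Sigma> T (JEqTm (Cv s \<gamma>) (Cv t \<delta>) B \<alpha>)"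
| Specific: "(Ms, J) \<in> T \<Longrightarrow> instantiation_of \<Sigma> Ms I \<Longrightarrow>
    \<forall>p\<in>set (inst_prems I). derivable \<Sigma> T p \<Longrightarrow>
    derivable_bdry \<Sigma> T (inst_bdry I (bdry_of J)) \<Longrightarrow>
    derivable \<Sigma> T (inst_jdg I J)"
| Congr_Ty: "(Ms, JTy A) \<in> T \<Longrightarrow> instantiation_of \<Sigma> Ms I \<Longrightarrow> instantiation_of \<Sigma> Ms I' \<Longrightarrow>
    \<forall>i\<in>set (obj_indices I'). er_arg (g' i) = er_arg (snd (I' ! i)) \<Longrightarrow>
    ps = inst_prems I @ inst_prems I' @ inst_eq_prems I g' \<alpha> \<Longrightarrow>
    \<forall>p\<in>set ps. derivable \<Sigma> T p \<Longrightarrow>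
    J = JEqTy (inst_ty I A) (inst_ty I' A) \<gamma> \<Longrightarrow> suitable ps J \<Longrightarrow>
    derivable \<Sigma> T J"
| Congr_Tm: "(Ms, JTm t A) \<in> T \<Longrightarrow> instantiation_of \<Sigma> Ms I \<Longrightarrow> instantiation_of \<Sigma> Ms I' \<Longrightarrow>
    \<forall>i\<in>set (obj_indices I'). er_arg (g' i) = er_arg (snd (I' ! i)) \<Longrightarrow>
    er_tm t' = er_tm (inst_tm I' t) \<Longrightarrow>
    ps = inst_prems I @ inst_prems I' @ inst_eq_prems I g' \<alpha> @ [JTm t' (inst_ty I A)] \<Longrightarrow>
    \<forall>p\<in>set ps. derivable \<Sigma> T p \<Longrightarrow>
    J = JEqTm (inst_tm I t) t' (inst_ty I A) \<gamma> \<Longrightarrow> suitable ps J \<Longrightarrow>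
    derivable \<Sigma> T J"
| Bdry_Ty: "derivable_bdry \<Sigma> T BTy"
| Bdry_Tm: "derivable \<Sigma> T (JTy A) \<Longrightarrow> derivable_bdry \<Sigma> T (BTm A)"
| Bdry_EqTy: "derivable \<Sigma> T (JTy A) \<Longrightarrow> derivable \<Sigma> T (JTy B) \<Longrightarrow>
    derivable_bdry \<Sigma> T (BEqTy A B)"
| Bdry_EqTm: "derivable \<Sigma> T (JTy A) \<Longrightarrow> derivable \<Sigma> T (JTm s A) \<Longrightarrow> derivable \<Sigma> T (JTm t A) \<Longrightarrow>
    derivable_bdry \<Sigma> T (BEqTm s t A)"
| Bdry_Abstr: "derivable \<Sigma> T (JTy A) \<Longrightarrow> derivable_bdry \<Sigma> T (subst_bdry \<B> (bind [Free a A])) \<Longrightarrow>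
    (a, A) |\<notin>| fv_bdry \<B> \<Longrightarrow> derivable_bdry \<Sigma> T (BAbs A \<B>)"

end

theory Submission
  imports Defs
begin

text \<open>
  An abstracted judgement can only be derived by the abstraction rule, so the premise is obtained
  by successively replacing \<open>y\<^sub>1, \<dots>, y\<^sub>k, x\<close> with annotated free variables. As \<open>x\<close> does not occur
  in \<open>\<J>\<close>, the innermost replacement leaves \<open>\<J>\<close> unchanged, because free variables are not recorded
  in a context. Abstracting the same free variables again, except the one for \<open>x\<close>, gives the claim.
  A judgement in which index \<open>0\<close> does not occur is represented as \<open>ren_jdg J Suc\<close>.
\<close>

section \<open>Renaming of bound variables\<close>

lemma up_ren_simps [simp]: "up_ren f 0 = 0" "up_ren f (Suc n) = Suc (f n)"
  by (simp_all add: up_ren_def)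

lemma up_ren_comp: "up_ren g (up_ren f n) = up_ren (\<lambda>n. g (f n)) n"
  by (cases n) simp_all

lemma Suc_mem_iff_unbind: "n |\<in>| unbind X \<longleftrightarrow> Suc n |\<in>| X"
proof
  assume "n |\<in>| unbind X"
  then obtain m where "m |\<in>| X" "m \<noteq> 0" "n = m - 1"
    by (auto simp: unbind_def)
  then show "Suc n |\<in>| X"
    by simp
next
  assume "Suc n |\<in>| X"
  then have "Suc n - 1 |\<in>| unbind X"
    unfolding unbind_def by (intro fimageI) simp
  then show "n |\<in>| unbind X"
    by simp
qed

text \<open>\<open>up_ren f\<close> fixes \<open>0\<close> and sends \<open>Suc m\<close> to
  \<open>Suc (f m)\<close>, so it commutes with discarding \<open>0\<close> and lowering the other
  indices.\<close>

lemma unbind_image_up_ren: "unbind (up_ren f |`| X) = f |`| unbind X"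
proof (rule fset_eqI)
  fix n
  have "Suc n |\<in>| up_ren f |`| X \<longleftrightarrow> (\<exists>m. Suc m |\<in>| X \<and> n = f m)"
    by (force simp: up_ren_def split: nat.splits)
  then show "n |\<in>| unbind (up_ren f |`| X) \<longleftrightarrow> n |\<in>| f |`| unbind X"
    by (force simp: Suc_mem_iff_unbind)
qed

lemma occurrences_ren_atom [simp]:
  "fv_atom (ren_atom f x) = fv_atom x"
  "bv_atom (ren_atom f x) = f |`| bv_atom x"
  "mv_atom (ren_atom f x) = mv_atom x"
  by (cases x; simp)+

lemma fimage_ffUnion: "f |`| ffUnion (g |`| X) = ffUnion ((\<lambda>x. f |`| g x) |`| X)"
  by (induction X) (auto simp: fimage_funion)

lemma fimage_ffUnion_list:
  "f |`| ffUnion (fset_of_list (map g xs)) = ffUnion (fset_of_list (map (\<lambda>x. f |`| g x) xs))"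
  by (induction xs) (auto simp: fimage_funion)

lemma fmember_ffUnion_list_iff:
  "y |\<in>| ffUnion (fset_of_list (map g xs)) \<longleftrightarrow> (\<exists>x\<in>set xs. y |\<in>| g x)"
  by (induction xs) auto

text \<open>Renaming never enters annotations, so atoms and boundaries carry no claim; their
  conclusions \<open>True\<close> only complete the induction over the five mutually recursive
  types.\<close>

lemma fv_ren:
  fixes A :: "'s ty" and t :: "'s tm" and e :: "'s arg" and x :: "'s atom" and B :: "'s bdry"
  shows "fv_ty (ren_ty A f) = fv_ty A"
    and "fv_tm (ren_tm t f) = fv_tm t"
    and "fv_arg (ren_arg e f) = fv_arg e"
    and True
    and True
  by (induction A and t and e and x and B arbitrary: f and f and f)
    (simp_all add: fset.map_comp comp_def cong: map_cong)

lemma mv_ren: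
  fixes A :: "'s ty" and t :: "'s tm" and e :: "'s arg" and x :: "'s atom" and B :: "'s bdry"
  shows "mv_ty (ren_ty A f) = mv_ty A"
    and "mv_tm (ren_tm t f) = mv_tm t"
    and "mv_arg (ren_arg e f) = mv_arg e"
    and True
    and True
  by (induction A and t and e and x and B arbitrary: f and f and f)
    (simp_all add: fset.map_comp comp_def cong: map_cong)

lemma bv_ren:
  fixes A :: "'s ty" and t :: "'s tm" and e :: "'s arg" and x :: "'s atom" and B :: "'s bdry"
  shows "bv_ty (ren_ty A f) = f |`| bv_ty A"
    and "bv_tm (ren_tm t f) = f |`| bv_tm t"
    and "bv_arg (ren_arg e f) = f |`| bv_arg e"
    and True
    and True
  by (induction A and t and e and x and B arbitrary: f and f and f)
    (simp_all add: fset.map_comp comp_def fimage_ffUnion fimage_ffUnion_list fimage_funion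
    unbind_image_up_ren cong: map_cong)

text \<open>Substitution replaces \<open>ABound n\<close> in an assumption set by
  \<open>asm_tm\<close> of a term; this equation lets a renaming pass through that
  replacement.\<close>

lemma asm_tm_ren: "asm_tm (ren_tm t f) = ren_atom f |`| asm_tm t"
  by (simp add: asm_tm_def atoms_def fv_ren mv_ren bv_ren fimage_funion fset.map_comp comp_def
      case_prod_unfold)

lemma up_ren_ident:
  assumes "\<And>n. n |\<in>| unbind X \<Longrightarrow> f n = n" and "n |\<in>| X"
  shows "up_ren f n = n"
  using assms by (cases n) (simp_all add: Suc_mem_iff_unbind)

lemma ren_atoms_ident:
  assumes "\<And>n. n |\<in>| bv_asmset \<alpha> \<Longrightarrow> f n = n"
  shows "ren_atom f |`| \<alpha> = \<alpha>"
proof -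
  have "ren_atom f x = x" if "x |\<in>| \<alpha>" for x
  proof (cases x)
    case (ABound n)
    then have "n |\<in>| bv_asmset \<alpha>"
      using that by (induction \<alpha>) (auto simp: bv_asmset_def)
    then show ?thesis
      using assms ABound by simp
  qed simp_all
  then show ?thesis
    by (metis fset.map_ident_strong)
qed

text \<open>Only occurring indices are constrained because the intended renaming,
  \<open>\<lambda>n. Suc (n - 1)\<close>, moves \<open>0\<close>.\<close>

lemma ren_ident:
  fixes A :: "'s ty" and t :: "'s tm" and e :: "'s arg" and x :: "'s atom" and B :: "'s bdry"
  shows "(\<And>n. n |\<in>| bv_ty A \<Longrightarrow> f n = n) \<Longrightarrow> ren_ty A f = A"
    and "(\<And>n. n |\<in>| bv_tm t \<Longrightarrow> f n = n) \<Longrightarrow> ren_tm t f = t"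
    and "(\<And>n. n |\<in>| bv_arg e \<Longrightarrow> f n = n) \<Longrightarrow> ren_arg e f = e"
    and True
    and True
proof (induction A and t and e and x and B arbitrary: f and f and f)
  case (ArgAbs e)
  then show ?case
    using up_ren_ident[of "bv_arg e" f] by simp
next
  case (Cv t \<alpha>)
  then show ?case
    using ren_atoms_ident[of \<alpha> f] by (simp add: bv_asmset_def)
next
  case (ArgAsm \<alpha>)
  then show ?case
    using ren_atoms_ident[of \<alpha> f] by (simp add: bv_asmset_def)
qed (auto simp: fmember_ffUnion_list_iff simp del: fset_of_list_map intro!: map_idI)

lemma ren_atom_comp: "ren_atom g (ren_atom f x) = ren_atom (\<lambda>n. g (f n)) x"
  by (cases x) simp_all

lemma ren_comp:
  fixes A :: "'s ty" and t :: "'s tm" and e :: "'s arg" and x :: "'s atom" and B :: "'s bdry"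
  shows "ren_ty (ren_ty A f) g = ren_ty A (\<lambda>n. g (f n))"
    and "ren_tm (ren_tm t f) g = ren_tm t (\<lambda>n. g (f n))"
    and "ren_arg (ren_arg e f) g = ren_arg e (\<lambda>n. g (f n))"
    and True
    and True
  by (induction A and t and e and x and B arbitrary: f g and f g and f g)
    (simp_all add: fset.map_comp comp_def ren_atom_comp up_ren_comp)

section \<open>Parallel substitution and its commutation with renaming\<close>

lemma up_simps [simp]: "up \<sigma> 0 = Bound 0" "up \<sigma> (Suc n) = ren_tm (\<sigma> n) Suc"
  by (simp_all add: up_def)

lemma up_Bound: "up Bound = Bound"
  by (rule ext) (simp add: up_def split: nat.splits)

lemma up_up_ren: "up \<sigma> (up_ren f n) = up (\<lambda>n. \<sigma> (f n)) n"
  by (cases n) simp_all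

lemma ren_up: "ren_tm (up \<sigma> n) (up_ren f) = up (\<lambda>n. ren_tm (\<sigma> n) f) n"
  by (cases n) (simp_all add: ren_comp)

lemma asm_tm_Bound [simp]: "asm_tm (Bound n) = {|ABound n|}"
  by (simp add: asm_tm_def atoms_def)

lemma subst_asmset_Bound: "subst_asmset \<alpha> Bound = \<alpha>"
proof -
  have "subst_atom Bound x = {|x|}" for x :: "'a atom"
    by (cases x) simp_all
  then show ?thesis
    by (induction \<alpha>) (auto simp: subst_asmset_def)
qed

lemma subst_asmset_ren: "subst_asmset (ren_atom f |`| \<alpha>) \<sigma> = subst_asmset \<alpha> (\<lambda>n. \<sigma> (f n))"
proof -
  have "subst_atom \<sigma> (ren_atom f x) = subst_atom (\<lambda>n. \<sigma> (f n)) x" for x :: "'a atom"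
    by (cases x) simp_all
  then show ?thesis
    by (simp add: subst_asmset_def fset.map_comp comp_def)
qed

lemma ren_subst_asmset: "ren_atom f |`| subst_asmset \<alpha> \<sigma> = subst_asmset \<alpha> (\<lambda>n. ren_tm (\<sigma> n) f)"
proof -
  have "ren_atom f |`| subst_atom \<sigma> x = subst_atom (\<lambda>n. ren_tm (\<sigma> n) f) x" for x :: "'a atom"
    by (cases x) (simp_all add: asm_tm_ren)
  then show ?thesis
    by (simp add: subst_asmset_def fimage_ffUnion)
qed

lemma subst_Bound:
  fixes A :: "'s ty" and t :: "'s tm" and e :: "'s arg" and x :: "'s atom" and B :: "'s bdry"
  shows "subst_ty A Bound = A"
    and "subst_tm t Bound = t"
    and "subst_arg e Bound = e"
    and True
    and True
  by (induction A and t and e and x and B)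
    (simp_all add: subst_asmset_Bound up_Bound map_idI)

lemma subst_ren:
  fixes A :: "'s ty" and t :: "'s tm" and e :: "'s arg" and x :: "'s atom" and B :: "'s bdry"
  shows "subst_ty (ren_ty A f) \<sigma> = subst_ty A (\<lambda>n. \<sigma> (f n))"
    and "subst_tm (ren_tm t f) \<sigma> = subst_tm t (\<lambda>n. \<sigma> (f n))"
    and "subst_arg (ren_arg e f) \<sigma> = subst_arg e (\<lambda>n. \<sigma> (f n))"
    and True
    and True
  by (induction A and t and e and x and B arbitrary: f \<sigma> and f \<sigma> and f \<sigma>)
    (simp_all add: subst_asmset_ren up_up_ren)

text \<open>Together with \<open>subst_ren\<close>, this collapses a renaming before or after a
  substitution into one substitution, so composites are compared index by index.\<close>

lemma ren_subst:
  fixes A :: "'s ty" and t :: "'s tm" and e :: "'s arg" and x :: "'s atom" and B :: "'s bdry"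
  shows "ren_ty (subst_ty A \<sigma>) f = subst_ty A (\<lambda>n. ren_tm (\<sigma> n) f)"
    and "ren_tm (subst_tm t \<sigma>) f = subst_tm t (\<lambda>n. ren_tm (\<sigma> n) f)"
    and "ren_arg (subst_arg e \<sigma>) f = subst_arg e (\<lambda>n. ren_tm (\<sigma> n) f)"
    and True
    and True
  by (induction A and t and e and x and B arbitrary: f \<sigma> and f \<sigma> and f \<sigma>)
    (simp_all add: ren_subst_asmset ren_up)

section \<open>Renaming and substitution in judgements\<close>

lemma fv_jdg_ren: "fv_jdg (ren_jdg J f) = fv_jdg J"
  by (induction J arbitrary: f)
    (simp_all add: fv_ren fv_asmset_def fset.map_comp comp_def)

lemma ren_jdg_comp: "ren_jdg (ren_jdg J f) g = ren_jdg J (\<lambda>n. g (f n))"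
  by (induction J arbitrary: f g)
    (simp_all add: ren_comp ren_atom_comp up_ren_comp fset.map_comp comp_def)

lemma subst_jdg_Bound: "subst_jdg J Bound = J"
  by (induction J) (simp_all add: subst_Bound subst_asmset_Bound up_Bound)

lemma subst_jdg_ren: "subst_jdg (ren_jdg J f) \<sigma> = subst_jdg J (\<lambda>n. \<sigma> (f n))"
  by (induction J arbitrary: f \<sigma>) (simp_all add: subst_ren subst_asmset_ren up_up_ren)

lemma ren_subst_jdg: "ren_jdg (subst_jdg J \<sigma>) f = subst_jdg J (\<lambda>n. ren_tm (\<sigma> n) f)"
  by (induction J arbitrary: f \<sigma>) (simp_all add: ren_subst ren_subst_asmset ren_up)

lemma ren_jdg_ident: "(\<And>n. n |\<in>| bv_jdg J \<Longrightarrow> f n = n) \<Longrightarrow> ren_jdg J f = J"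
proof (induction J arbitrary: f)
  case (JAbs A J)
  then show ?case
    using up_ren_ident[of "bv_jdg J" f] by (simp add: ren_ident)
qed (simp_all add: ren_ident ren_atoms_ident)

lemma ren_Suc_unshift_jdg:
  assumes "0 |\<notin>| bv_jdg J"
  shows "ren_jdg (unshift_jdg J) Suc = J"
proof -
  have "Suc (n - 1) = n" if "n |\<in>| bv_jdg J" for n
    using that assms by (cases n) simp_all
  then show ?thesis
    by (simp add: unshift_jdg_def ren_jdg_comp ren_jdg_ident)
qed

text \<open>Both sides collapse to substituting \<open>\<lambda>n. ren_tm (\<sigma> n) Suc\<close>
  in \<open>J\<close>. Thus a vacuous binder stays vacuous when outer variables are
  substituted.\<close>

lemma subst_jdg_ren_Suc_up: "subst_jdg (ren_jdg J Suc) (up \<sigma>) = ren_jdg (subst_jdg J \<sigma>) Suc"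
  by (simp add: subst_jdg_ren ren_subst_jdg)

text \<open>\<open>bind [t] (Suc n)\<close> is \<open>Bound n\<close>, so substituting for the
  vacuous variable undoes the shift.\<close>

lemma subst_jdg_ren_Suc_bind: "subst_jdg (ren_jdg J Suc) (bind [t]) = J"
  by (simp add: subst_jdg_ren bind_def subst_jdg_Bound)

section \<open>Inversion of abstractions and removal of the vacuous one\<close>

lemma fill_meta_app_neq_JAbs: "fill (subst_bdry (core B) \<sigma>) (meta_app M B ts) \<noteq> JAbs A J"
proof -
  \<comment> \<open>Equality of classes ensures that \<open>meta_app\<close> supplies the
    constructor for which \<open>fill\<close> is specified at a type or term boundary.\<close>
  have "cls_of (core B) = cls_of B" and "doms (core B) = []"
    by (induction B) simp_all
  then show ?thesis
    by (cases "core B") (auto simp: meta_app_def split: cls.splits)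
qed

text \<open>Besides \<open>Abstr\<close>, only \<open>Meta\<close> and \<open>Specific\<close> leave
  the form of their conclusion open. Filling a \<open>core\<close> gives no abstraction, and
  instantiating the non-abstracted conclusion of a raw rule keeps its outermost constructor.\<close>

lemma derivable_JAbsE:
  assumes "raw_type_theory \<Sigma> T" and "derivable \<Sigma> T (JAbs A J)"
  obtains a where "derivable \<Sigma> T (JTy A)"
    and "derivable \<Sigma> T (subst_jdg J (bind [Free a A]))" and "(a, A) |\<notin>| fv_jdg J"
  using assms(2)
proof cases
  case (Meta M B ts)
  then show ?thesis
    using fill_meta_app_neq_JAbs by metis
next
  case (Specific Ms J' I)
  then have "\<nexists>A J''. J' = JAbs A J''"
    using assms(1) by (auto simp: raw_type_theory_def raw_rule_def)
  then show ?thesis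
    using Specific(1) by (cases J') simp_all
qed (use that in auto)

text \<open>In a telescope each type lies under the binders of the earlier ones, hence one more
  \<open>up\<close> per entry.\<close>

fun subst_tys :: "'s ty list \<Rightarrow> (nat \<Rightarrow> 's tm) \<Rightarrow> 's ty list" where
  "subst_tys [] \<sigma> = []"
| "subst_tys (B # Bs) \<sigma> = subst_ty B \<sigma> # subst_tys Bs (up \<sigma>)"

lemma length_subst_tys [simp]: "length (subst_tys Bs \<sigma>) = length Bs"
  by (induction Bs arbitrary: \<sigma>) simp_all

lemma subst_jdg_foldr_JAbs:
  "subst_jdg (foldr JAbs Bs J) \<sigma> = foldr JAbs (subst_tys Bs \<sigma>) (subst_jdg J ((up ^^ length Bs) \<sigma>))"
  by (induction Bs arbitrary: \<sigma>) (simp_all add: funpow_swap1)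

lemma fv_jdg_foldr_JAbs:
  "fv_jdg (foldr JAbs Bs J) = ffUnion (fset_of_list (map fv_ty Bs)) |\<union>| fv_jdg J"
  by (induction Bs) auto

text \<open>The form \<open>ren_jdg J Suc\<close> makes the hypothesis stable under substitution.
  The induction is on the length because opening the outermost binder also substitutes into the
  remaining types, so the new list need not be a tail of \<open>Bs\<close>.\<close>

lemma derivable_remove_vacuous:
  assumes "raw_type_theory \<Sigma> T" and "derivable \<Sigma> T (foldr JAbs Bs (JAbs A (ren_jdg J Suc)))"
  shows "derivable \<Sigma> T (foldr JAbs Bs J)"
  using assms(2)
proof (induction "length Bs" arbitrary: Bs A J)
  case 0
  then show ?case
    by (auto elim: derivable_JAbsE[OF assms(1)] simp: subst_jdg_ren_Suc_bind)
next
  case (Suc k)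
  then obtain B Bs' where Bs: "Bs = B # Bs'" and k: "k = length Bs'"
    by (cases Bs) auto
  let ?J = "foldr JAbs Bs' (JAbs A (ren_jdg J Suc))"
  have "derivable \<Sigma> T (JAbs B ?J)"
    using Suc.prems by (simp add: Bs)
  then obtain b where B: "derivable \<Sigma> T (JTy B)"
    and inst: "derivable \<Sigma> T (subst_jdg ?J (bind [Free b B]))"
    and fresh: "(b, B) |\<notin>| fv_jdg ?J"
    by (rule derivable_JAbsE[OF assms(1)])
  \<comment> \<open>The induction hypothesis applies to
    \<open>subst_tys Bs' (bind [Free b B])\<close>, with \<open>A\<close> and \<open>J\<close>
    substituted along the lifted substitution.\<close>
  have "derivable \<Sigma> T (subst_jdg (foldr JAbs Bs' J) (bind [Free b B]))"
    using inst Suc.hyps(1) by (simp add: k subst_jdg_foldr_JAbs subst_jdg_ren_Suc_up)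
  \<comment> \<open>Dropping \<open>A\<close> can only remove free variables and shifting keeps
    them, so the same \<open>b\<close> serves to abstract again.\<close>
  moreover have "(b, B) |\<notin>| fv_jdg (foldr JAbs Bs' J)"
    using fresh by (simp add: fv_jdg_foldr_JAbs fv_jdg_ren)
  ultimately show ?case
    using B by (auto simp: Bs intro: Abstr)
qed

theorem mainTheorem12:
  fixes \<Sigma> :: "'s signature" and T :: "'s rule set"
    and Bs :: "'s ty list" and A :: "'s ty" and J :: "'s jdg"
  assumes "raw_type_theory \<Sigma> T"
    and "derivable \<Sigma> T (foldr JAbs Bs (JAbs A J))"
    and "0 |\<notin>| bv_jdg J"
  shows "derivable \<Sigma> T (foldr JAbs Bs (unshift_jdg J))"
  using assms derivable_remove_vacuous[OF assms(1), of Bs A "unshift_jdg J"]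
  by (simp add: ren_Suc_unshift_jdg)

end
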